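(* Let $k$ be a field of characteristic $0$, let $S=k[x_1,\ldots,x_n]$, let $T=k[\partial_1,\ldots,\partial_n]$ be the ring of differential operators acting on $S$, and let $f\in S_d$ be a homogeneous polynomial of degree $d\geq 1$. Then $$N_{\mathrm{ess}}(f)=\operatorname{rk}(\mathcal{C}_f),$$ i.e. the number of essential variables of $f$ is the rank of its first catalecticant matrix, and $$\mathrm{EssVar}(f)=\langle D\circ f : D\in T_{d-1}\rangle,$$ i.e. for any linear forms $y_1,\ldots,y_r\in S_1$ with $r=N_{\mathrm{ess}}(f)$ and $f\in k[y_1,\ldots,y_r]$, the $k$-span $\langle y_1,\ldots,y_r\rangle$ equals the $k$-vector space spanned by the $(d-1)$-th order partial derivatives of $f$.
   Context: $S_i$ and $T_i$ denote the degree-$i$ homogeneous components of $S=k[x_1,\ldots,x_n]$ and $T=k[\partial_1,\ldots,\partial_n]$ (standard grading). $T$ acts on $S$ by differentiation, the action being denoted $\circ$: $\partial_j\circ f=\frac{\partial f}{\partial x_j}$, extended so that $S$ is a $T$-module. $\langle\cdot\rangle$ denotes the $k$-linear span. Number of essential variables: for a form (homogeneous polynomial) $f\in S$, $N_{\mathrm{ess}}(f)$ is the smallest integer $r$ such that there exist linear forms $y_1,\ldots,y_r\in S_1$ with $f\in k[y_1,\ldots,y_r]$ (the $k$-subalgebra of $S$ generated by the $y_i$). For such linear forms with $r=N_{\mathrm{ess}}(f)$, $\mathrm{EssVar}(f)$ denotes the $k$-vector space $\langle y_1,\ldots,y_r\rangle\subseteq S_1$; any set of generators of it is called a set of essential variables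 of $f$. First catalecticant matrix: for $f\in S_d$, let $\{M_1,\ldots,M_N\}$ be the standard monomial basis of $S_{d-1}$ (in a fixed order, e.g. lex), and write $\partial_i\circ f=c_{i1}M_1+\cdots+c_{iN}M_N$ for $i=1,\ldots,n$. Then $\mathcal{C}_f$ is the $n\times N$ matrix over $k$ with entries $(\mathcal{C}_f)_{ij}=c_{ij}$. *)

theory Defs
  imports "HOL-Library.Poly_Mapping" "Jordan_Normal_Form.DL_Rank"
begin

abbreviation lookup :: "('a \<Rightarrow>\<^sub>0 'b::zero) \<Rightarrow> 'a \<Rightarrow> 'b" where "lookup \<equiv> Poly_Mapping.lookup"
abbreviation keys :: "('a \<Rightarrow>\<^sub>0 'b::zero) \<Rightarrow> 'a set" where "keys \<equiv> Poly_Mapping.keys"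

text \<open>
  Exponent vectors are finitely supported functions on the variable indices, and polynomials are
  finitely supported coefficient functions on exponent vectors; the product on polynomials is the
  convolution product. The variables \<open>x\<^sub>1, \<dots>, x\<^sub>n\<close> are indexed by \<open>0, \<dots>, n - 1\<close>, and a polynomial
  lies in \<open>k[x\<^sub>1, \<dots>, x\<^sub>n]\<close> if only exponent vectors supported on \<open>{..<n}\<close> occur in it.
\<close>

type_synonym monom_exp = "nat \<Rightarrow>\<^sub>0 nat"
type_synonym 'k mvpoly = "monom_exp \<Rightarrow>\<^sub>0 'k"

definition monomials :: "nat \<Rightarrow> nat \<Rightarrow> monom_exp set" where
  "monomials n d = {m. keys m \<subseteq> {..<n} \<and> (\<Sum>i<n. lookup m i) = d}"

text \<open>
  \<open>forms n d\<close> serves both as \<open>S\<^sub>d\<close> and as \<open>T\<^sub>d\<close>; an element of \<open>T\<close> is a polynomial whose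
  \<open>i\<close>-th variable stands for \<open>\<partial>\<^sub>i\<close>.
\<close>

definition forms :: "nat \<Rightarrow> nat \<Rightarrow> 'k::zero mvpoly set" where
  "forms n d = {f. keys f \<subseteq> monomials n d}"

definition const :: "'k::zero \<Rightarrow> 'k mvpoly" where
  "const c = Poly_Mapping.single 0 c"

definition pscale :: "'k::field \<Rightarrow> 'k mvpoly \<Rightarrow> 'k mvpoly" where
  "pscale c f = const c * f"

global_interpretation mvpoly: vector_space pscale
  defines mvpoly_span = mvpoly.span
  by standard
    (simp_all add: pscale_def const_def algebra_simps single_add mult_single flip: mult.assoc)

subsection \<open>The action by differentiation\<close>

definition pdiff :: "nat \<Rightarrow> 'k::field mvpoly \<Rightarrow> 'k mvpoly" where
  "pdiff i f = (\<Sum>m\<in>keys f. Poly_Mapping.single (m - Poly_Mapping.single i 1)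
                                 (of_nat (lookup m i) * lookup f m))"

text \<open>
  If \<open>x\<^sub>i\<close> does not occur in the monomial \<open>m\<close>, the truncated subtraction in the exponent is harmless
  since the coefficient vanishes.
\<close>

definition pdiff_monom :: "nat \<Rightarrow> monom_exp \<Rightarrow> 'k::field mvpoly \<Rightarrow> 'k mvpoly" where
  "pdiff_monom n m = foldr (\<lambda>i. pdiff i ^^ lookup m i) [0..<n]"

definition diff_act :: "nat \<Rightarrow> 'k::field mvpoly \<Rightarrow> 'k mvpoly \<Rightarrow> 'k mvpoly" where
  "diff_act n D f = (\<Sum>m\<in>keys D. pscale (lookup D m) (pdiff_monom n m f))"

lemma lookup_pdiff:
  "lookup (pdiff i f) m = of_nat (Suc (lookup m i)) * lookup f (m + Poly_Mapping.single i 1)"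
proof -
  let ?s = "Poly_Mapping.single i (1::nat)"
  have *: "lookup (Poly_Mapping.single (m' - ?s) (of_nat (lookup m' i) * lookup f m')) m =
     (if m' = m + ?s then of_nat (Suc (lookup m i)) * lookup f m' else 0)" for m'
  proof (cases "lookup m' i = 0")
    case True
    then have "m' \<noteq> m + ?s"
      by (auto simp: lookup_add)
    with True show ?thesis by simp
  next
    case False
    have "m' - ?s = m \<longleftrightarrow> m' = m + ?s"
    proof
      assume m: "m' - ?s = m"
      show "m' = m + ?s"
        unfolding m[symmetric] using False
        by (intro poly_mapping_eqI) (auto simp: lookup_add lookup_minus lookup_single when_def)
    qed simp
    then show ?thesis
      by (auto simp: lookup_single lookup_add)
  qed
  have "lookup (pdiff i f) m =
      (\<Sum>m'\<in>keys f. if m' = m + ?s then of_nat (Suc (lookup m i)) * lookup f m' else 0)"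
    unfolding pdiff_def lookup_sum by (intro sum.cong refl *)
  then show ?thesis
    by (simp add: in_keys_iff del: of_nat_Suc)
qed

lemma lookup_const_mult: "lookup (const c * f) m = c * lookup f m"
proof -
  have "const c * f = Poly_Mapping.map ((*) c) f"
    unfolding const_def by (simp add: mult_map_scale_conv_mult)
  then show ?thesis by (simp add: Poly_Mapping.map.rep_eq when_def)
qed

lemma lookup_pscale: "lookup (pscale c f) m = c * lookup f m"
  by (simp add: pscale_def lookup_const_mult)

lemma pdiff_add: "pdiff i (f + g) = pdiff i f + pdiff i g"
  by (rule poly_mapping_eqI) (simp add: lookup_pdiff lookup_add algebra_simps)

lemma pdiff_pscale: "pdiff i (pscale c f) = pscale c (pdiff i f)"
  by (rule poly_mapping_eqI) (simp add: lookup_pdiff lookup_pscale)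

lemma pdiff_commute: "pdiff i (pdiff j f) = pdiff j (pdiff i f)"
  by (rule poly_mapping_eqI)
    (auto simp: lookup_pdiff lookup_add lookup_single when_def ac_simps)

lemma pdiff_pow_add: "(pdiff i ^^ a) (f + g) = (pdiff i ^^ a) f + (pdiff i ^^ a) g"
  by (induction a) (simp_all add: pdiff_add)

lemma pdiff_pow_pscale: "(pdiff i ^^ a) (pscale c f) = pscale c ((pdiff i ^^ a) f)"
  by (induction a) (simp_all add: pdiff_pscale)

lemma pdiff_pow_commute:
  "(pdiff i ^^ a) ((pdiff j ^^ b) f) = (pdiff j ^^ b) ((pdiff i ^^ a) f)"
proof -
  have step: "pdiff i ((pdiff j ^^ b) g) = (pdiff j ^^ b) (pdiff i g)" for g
    by (induction b) (simp_all add: pdiff_commute[of i j])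
  show ?thesis
    by (induction a) (simp_all add: step)
qed

lemma pdiff_monom_add: "pdiff_monom n m (f + g) = pdiff_monom n m f + pdiff_monom n m g"
proof -
  have "foldr (\<lambda>i. pdiff i ^^ lookup m i) xs (f + g) =
      foldr (\<lambda>i. pdiff i ^^ lookup m i) xs f + foldr (\<lambda>i. pdiff i ^^ lookup m i) xs g" for xs
    by (induction xs) (simp_all add: pdiff_pow_add)
  then show ?thesis by (simp add: pdiff_monom_def)
qed

lemma pdiff_monom_pscale: "pdiff_monom n m (pscale c f) = pscale c (pdiff_monom n m f)"
proof -
  have "foldr (\<lambda>i. pdiff i ^^ lookup m i) xs (pscale c f) =
      pscale c (foldr (\<lambda>i. pdiff i ^^ lookup m i) xs f)" for xs
    by (induction xs) (simp_all add: pdiff_pow_pscale)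
  then show ?thesis by (simp add: pdiff_monom_def)
qed

lemma pdiff_monom_0 [simp]: "pdiff_monom n m 0 = 0"
  using pdiff_monom_pscale[of n m 0 0] by simp

lemma pdiff_monom_sum: "pdiff_monom n m (sum h A) = (\<Sum>a\<in>A. pdiff_monom n m (h a))"
  by (induction A rule: infinite_finite_induct) (simp_all add: pdiff_monom_add)

lemma pdiff_monom_mult:
  "pdiff_monom n (m + m') f = pdiff_monom n m (pdiff_monom n m' f)"
proof -
  have comm: "(pdiff j ^^ b) (foldr (\<lambda>i. pdiff i ^^ lookup m i) xs g) =
      foldr (\<lambda>i. pdiff i ^^ lookup m i) xs ((pdiff j ^^ b) g)" for j b xs and g :: "'a mvpoly"
  proof (induction xs)
    case (Cons a xs)
    show ?case
      unfolding foldr_Cons o_apply pdiff_pow_commute[of b j "lookup m a" a] Cons.IH ..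
  qed simp
  have "foldr (\<lambda>i. pdiff i ^^ lookup (m + m') i) xs f =
      foldr (\<lambda>i. pdiff i ^^ lookup m i) xs (foldr (\<lambda>i. pdiff i ^^ lookup m' i) xs f)" for xs
    by (induction xs) (simp_all add: lookup_add funpow_add comm)
  then show ?thesis by (simp add: pdiff_monom_def)
qed

lemma diff_act_superset:
  assumes "finite A" "keys D \<subseteq> A"
  shows "diff_act n D f = (\<Sum>m\<in>A. pscale (lookup D m) (pdiff_monom n m f))"
  unfolding diff_act_def using assms
  by (intro sum.mono_neutral_left) (auto simp: in_keys_iff)

lemma diff_act_add_left: "diff_act n (D + E) f = diff_act n D f + diff_act n E f"
  using keys_add[of D E]
  by (simp add: diff_act_superset[of "keys D \<union> keys E"] lookup_add mvpoly.scale_left_distrib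
      sum.distrib)

lemma diff_act_0_left [simp]: "diff_act n 0 f = 0"
  by (simp add: diff_act_def)

lemma diff_act_sum_left: "diff_act n (sum h A) f = (\<Sum>a\<in>A. diff_act n (h a) f)"
  by (induction A rule: infinite_finite_induct) (simp_all add: diff_act_add_left)

lemma diff_act_add_right: "diff_act n D (f + g) = diff_act n D f + diff_act n D g"
  by (simp add: diff_act_def pdiff_monom_add mvpoly.scale_right_distrib sum.distrib)

lemma diff_act_single:
  "diff_act n (Poly_Mapping.single m c) f = pscale c (pdiff_monom n m f)"
  by (simp add: diff_act_def)

lemma diff_act_const: "diff_act n (const c) f = pscale c f"
proof -
  have "foldr (\<lambda>i. pdiff i ^^ 0) xs f = f" for xs
    by (induction xs) simp_all
  then show ?thesis
    by (simp add: const_def diff_act_single pdiff_monom_def)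
qed

lemma diff_act_one: "diff_act n 1 f = f"
  using diff_act_const[of n 1 f] by (simp add: const_def)

lemma diff_act_var:
  assumes "i < n"
  shows "diff_act n (Poly_Mapping.single (Poly_Mapping.single i 1) 1) f = pdiff i f"
proof -
  have "foldr (\<lambda>j. pdiff j ^^ lookup (Poly_Mapping.single i (1::nat)) j) xs f =
      (if i \<in> set xs then pdiff i f else f)" if "distinct xs" for xs
    using that by (induction xs) (auto simp: lookup_single when_def)
  with assms show ?thesis
    by (simp add: diff_act_single pdiff_monom_def)
qed

lemma mvpoly_sum_monom: "f = (\<Sum>m\<in>keys f. Poly_Mapping.single m (lookup f m))"
  by (rule poly_mapping_eqI) (simp add: lookup_sum lookup_single when_def in_keys_iff)

lemma diff_act_mult: "diff_act n (D * E) f = diff_act n D (diff_act n E f)"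
proof -
  have "D * E = (\<Sum>m\<in>keys D. \<Sum>m'\<in>keys E.
      Poly_Mapping.single (m + m') (lookup D m * lookup E m'))"
    by (subst (1) mvpoly_sum_monom[of D], subst (1) mvpoly_sum_monom[of E])
      (simp add: sum_product mult_single)
  then show ?thesis
    by (simp add: diff_act_sum_left diff_act_single diff_act_def[of n D] diff_act_def[of n E]
        pdiff_monom_sum pdiff_monom_pscale pdiff_monom_mult mvpoly.scale_sum_right)
qed

subsection \<open>Essential variables\<close>

inductive_set subalg :: "'k::field mvpoly set \<Rightarrow> 'k mvpoly set" for Y where
  const: "const c \<in> subalg Y"
| gen: "y \<in> Y \<Longrightarrow> y \<in> subalg Y"
| add: "f \<in> subalg Y \<Longrightarrow> g \<in> subalg Y \<Longrightarrow> f + g \<in> subalg Y"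
| mult: "f \<in> subalg Y \<Longrightarrow> g \<in> subalg Y \<Longrightarrow> f * g \<in> subalg Y"

definition N_ess :: "nat \<Rightarrow> 'k::field mvpoly \<Rightarrow> nat" where
  "N_ess n f = (LEAST r. \<exists>ys. length ys = r \<and> set ys \<subseteq> forms n 1 \<and> f \<in> subalg (set ys))"

definition minimal_linear_forms :: "nat \<Rightarrow> 'k::field mvpoly \<Rightarrow> 'k mvpoly list \<Rightarrow> bool" where
  "minimal_linear_forms n f ys \<longleftrightarrow>
     length ys = N_ess n f \<and> set ys \<subseteq> forms n 1 \<and> f \<in> subalg (set ys)"

text \<open>
  That the span is the same for all minimal choices of linear forms is not assumed: without it, the
  description operator below would be unspecified.
\<close>

definition EssVar :: "nat \<Rightarrow> 'k::field mvpoly \<Rightarrow> 'k mvpoly set" where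
  "EssVar n f = (THE V. \<exists>ys. minimal_linear_forms n f ys \<and> V = mvpoly_span (set ys))"

subsection \<open>The first catalecticant matrix\<close>

text \<open>
  The list \<open>Ms\<close> is the chosen ordering of the monomial basis of \<open>S\<^bsub>d-1\<^esub>\<close>.
\<close>

definition catalecticant :: "nat \<Rightarrow> monom_exp list \<Rightarrow> 'k::field mvpoly \<Rightarrow> 'k mat" where
  "catalecticant n Ms f = mat n (length Ms) (\<lambda>(i, j). lookup (pdiff i f) (Ms ! j))"

end

theory Submission
  imports Defs
begin

text \<open>
  For every monomial \<open>M\<close>, the coefficients at \<open>M\<close> of the partial derivatives of \<open>f\<close> make up a linear
  form \<open>g\<^sub>M\<close>. The forms \<open>g\<^sub>M\<close> with \<open>M\<close> of degree \<open>d - 1\<close> are the columns of the catalecticant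
  matrix, and in characteristic 0 they agree up to nonzero factors with the derivatives of order
  \<open>d - 1\<close>; hence their span \<open>W\<close> has dimension equal to the rank. By Leibniz' rule, all \<open>g\<^sub>M\<close> lie in
  \<open>\<langle>y\<^sub>1, \<dots>, y\<^sub>r\<rangle>\<close> whenever \<open>f \<in> k[y\<^sub>1, \<dots>, y\<^sub>r]\<close>, so at least \<open>dim W\<close> linear forms are needed, and exactly
  \<open>dim W\<close> of them must span \<open>W\<close>. Conversely, a projection \<open>P\<close> onto \<open>W\<close> turns Euler's identity into
  \<open>d f = \<Sum>\<^sub>i P(x\<^sub>i) (\<partial>\<^sub>i \<circ> f)\<close>, and induction on the degree shows \<open>f \<in> k[W]\<close>.
\<close>

text \<open>Keeps \<open>1\<close> from being rewritten to \<open>Suc 0\<close>, so that facts about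
  \<open>var_exp\<close> and \<open>forms n 1\<close> keep matching.\<close>

declare One_nat_def [simp del]

abbreviation var_exp :: "nat \<Rightarrow> monom_exp" where
  "var_exp i \<equiv> Poly_Mapping.single i 1"

subsection \<open>Linear forms\<close>

text \<open>The isomorphism from \<open>k^n\<close> to \<open>S\<^sub>1\<close>. Only the values of
  \<open>h\<close> below \<open>n\<close> enter, so coefficient functions and vectors, as
  \<open>($) v\<close>, are treated alike.\<close>

definition linear_form :: "nat \<Rightarrow> (nat \<Rightarrow> 'k::field) \<Rightarrow> 'k mvpoly" where
  "linear_form n h = (\<Sum>i<n. Poly_Mapping.single (var_exp i) (h i))"

lemma var_exp_eq_iff [simp]: "var_exp i = var_exp j \<longleftrightarrow> i = j"
  by (metis lookup_single_eq lookup_single_not_eq zero_neq_one)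

lemma monomials_1: "monomials n 1 = var_exp ` {..<n}"
proof (intro equalityI subsetI)
  fix m assume m: "m \<in> monomials n 1"
  then have "(\<Sum>i<n. lookup m i) = 1" by (simp add: monomials_def)
  then obtain i where i: "i < n" "lookup m i = 1" "\<forall>j<n. j \<noteq> i \<longrightarrow> lookup m j = 0"
    by (auto simp: sum_eq_1_iff)
  have "m = var_exp i"
  proof (rule poly_mapping_eqI)
    fix j
    show "lookup m j = lookup (var_exp i) j"
      using i m by (cases "j < n") (auto simp: lookup_single when_def monomials_def in_keys_iff)
  qed
  with i show "m \<in> var_exp ` {..<n}" by blast
next
  fix m assume "m \<in> var_exp ` {..<n}"
  then show "m \<in> monomials n 1"
    by (auto simp: monomials_def lookup_single when_def)
qed

lemma lookup_linear_form_var: "i < n \<Longrightarrow> lookup (linear_form n h) (var_exp i) = h i"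
  by (simp add: linear_form_def lookup_sum lookup_single when_def)

lemma lookup_linear_form_other: "m \<notin> monomials n 1 \<Longrightarrow> lookup (linear_form n h) m = 0"
  unfolding monomials_1
  by (auto simp: linear_form_def lookup_sum lookup_single when_def intro!: sum.neutral)

lemma linear_form_in_forms: "linear_form n h \<in> forms n 1"
  unfolding forms_def by (auto simp: in_keys_iff lookup_linear_form_other intro: ccontr)

lemma forms_1_eqI:
  assumes "f \<in> forms n 1" "g \<in> forms n 1"
    and "\<And>i. i < n \<Longrightarrow> lookup f (var_exp i) = lookup g (var_exp i)"
  shows "f = g"
proof (rule poly_mapping_eqI)
  fix m
  show "lookup f m = lookup g m"
  proof (cases "m \<in> monomials n 1")
    case True
    with assms(3) show ?thesis by (auto simp: monomials_1)
  next
    case False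
    with assms(1,2) have "m \<notin> keys f" "m \<notin> keys g" by (auto simp: forms_def)
    then show ?thesis by (simp add: in_keys_iff)
  qed
qed

lemma linear_form_coeffs: "y \<in> forms n 1 \<Longrightarrow> linear_form n (\<lambda>i. lookup y (var_exp i)) = y"
  by (rule forms_1_eqI[OF linear_form_in_forms]) (auto simp: lookup_linear_form_var)

lemma linear_form_add: "linear_form n (\<lambda>i. g i + h i) = linear_form n g + linear_form n h"
  by (simp add: linear_form_def single_add sum.distrib)

lemma pscale_single: "pscale c (Poly_Mapping.single m a) = Poly_Mapping.single m (c * a)"
  by (simp add: pscale_def const_def mult_single)

lemma linear_form_scale: "linear_form n (\<lambda>i. c * h i) = pscale c (linear_form n h)"
  by (simp add: linear_form_def pscale_single mvpoly.scale_sum_right)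

lemma linear_form_0: "linear_form n (\<lambda>i. 0) = 0"
  by (simp add: linear_form_def)

lemma linear_form_sum: "linear_form n (\<lambda>i. \<Sum>a\<in>A. h a i) = (\<Sum>a\<in>A. linear_form n (h a))"
  by (induction A rule: infinite_finite_induct) (simp_all add: linear_form_0 linear_form_add)

lemma linear_form_eq_0_iff: "linear_form n h = 0 \<longleftrightarrow> (\<forall>i<n. h i = 0)"
proof
  assume "linear_form n h = 0"
  then show "\<forall>i<n. h i = 0" by (metis lookup_linear_form_var lookup_zero)
qed (simp add: linear_form_def)

lemma subspace_forms: "mvpoly.subspace (forms n d)"
proof (rule mvpoly.subspaceI)
  show "f + g \<in> forms n d" if "f \<in> forms n d" "g \<in> forms n d" for f g :: "'a mvpoly"
    using that keys_add[of f g] unfolding forms_def by blast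
qed (auto simp: forms_def in_keys_iff lookup_pscale subset_iff)

subsection \<open>Products, derivatives and Euler's identity\<close>

text \<open>The existence of \<open>b\<close> says that the monomial \<open>a\<close> divides
  \<open>m\<close>; only then is the truncated difference \<open>m - a\<close> the exponent of the
  quotient.\<close>

lemma lookup_single_mult:
  "lookup (Poly_Mapping.single a c * g) m =
    (if \<exists>b. m = a + b then c * lookup g (m - a) else 0)" for g :: "'k::field mvpoly"
proof -
  have "lookup (Poly_Mapping.single a c * g) m =
      (\<Sum>b\<in>keys g. c * lookup g b when a + b = m)"
    by (subst mvpoly_sum_monom[of g])
      (simp add: sum_distrib_left mult_single lookup_sum lookup_single)
  also have "\<dots> = (if \<exists>b. m = a + b then c * lookup g (m - a) else 0)"
  proof (cases "\<exists>b. m = a + b")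
    case True
    then obtain b where "m = a + b" by blast
    then show ?thesis by (simp add: when_def in_keys_iff)
  qed (auto simp: when_def intro!: sum.neutral)
  finally show ?thesis .
qed

lemma lookup_mult_left:
  "lookup (f * g) m =
    (\<Sum>a\<in>keys f. if \<exists>b. m = a + b then lookup f a * lookup g (m - a) else 0)"
  for f g :: "'k::field mvpoly"
  by (subst mvpoly_sum_monom[of f]) (simp add: sum_distrib_right lookup_sum lookup_single_mult)

lemma pdiff_single:
  "pdiff i (Poly_Mapping.single m c) =
    Poly_Mapping.single (m - var_exp i) (of_nat (lookup m i) * c)"
  by (simp add: pdiff_def)

lemma pdiff_0 [simp]: "pdiff i 0 = 0"
  by (simp add: pdiff_def)

lemma pdiff_sum: "pdiff i (sum h A) = (\<Sum>a\<in>A. pdiff i (h a))"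
  by (induction A rule: infinite_finite_induct) (simp_all add: pdiff_add)

lemma diff_var_exp_add:
  assumes "lookup m i \<noteq> 0"
  shows "m + m' - var_exp i = (m - var_exp i) + m'"
  using assms
  by (intro poly_mapping_eqI) (auto simp: lookup_add lookup_minus lookup_single when_def)

lemma pdiff_mult_single:
  fixes a b :: "'k::field"
  shows "pdiff i (Poly_Mapping.single m a * Poly_Mapping.single m' b) =
    Poly_Mapping.single m a * pdiff i (Poly_Mapping.single m' b) +
    pdiff i (Poly_Mapping.single m a) * Poly_Mapping.single m' b"
proof -
  \<comment> \<open>When \<open>x\<^sub>i\<close> does not divide \<open>m'\<close>, truncation can
    make the two exponents differ, but then the coefficient is zero.\<close>
  have "Poly_Mapping.single (m + m' - var_exp i) (of_nat (lookup m' i) * (a * b)) =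
      Poly_Mapping.single (m + (m' - var_exp i)) (of_nat (lookup m' i) * (a * b))"
    using diff_var_exp_add[of m' i m] by (cases "lookup m' i = 0") (simp_all add: add.commute)
  moreover have "Poly_Mapping.single (m + m' - var_exp i) (of_nat (lookup m i) * (a * b)) =
      Poly_Mapping.single ((m - var_exp i) + m') (of_nat (lookup m i) * (a * b))"
    using diff_var_exp_add[of m i m'] by (cases "lookup m i = 0") simp_all
  ultimately show ?thesis
    by (simp add: mult_single pdiff_single lookup_add distrib_left distrib_right single_add
        mult.left_commute mult.assoc add.commute)
qed

text \<open>Both sides are bilinear, so Leibniz' rule reduces to monomials, first in
  \<open>g\<close> and then in \<open>f\<close>.\<close>

lemma pdiff_mult: "pdiff i (f * g) = f * pdiff i g + pdiff i f * g"
proof -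
  have single: "pdiff i (Poly_Mapping.single m a * g) =
      Poly_Mapping.single m a * pdiff i g + pdiff i (Poly_Mapping.single m a) * g" for m a
    by (subst (1 2 3) mvpoly_sum_monom[of g])
      (simp add: sum_distrib_left pdiff_sum pdiff_mult_single sum.distrib)
  show ?thesis
    by (subst (1 2 3) mvpoly_sum_monom[of f])
      (simp add: sum_distrib_right pdiff_sum single sum.distrib)
qed

lemma pdiff_in_forms:
  assumes "f \<in> forms n (Suc d)"
  shows "pdiff i f \<in> forms n d"
  unfolding forms_def
proof (intro CollectI subsetI)
  fix m assume "m \<in> keys (pdiff i f)"
  then have "m + var_exp i \<in> keys f" by (auto simp: in_keys_iff lookup_pdiff)
  with assms have m: "keys (m + var_exp i) \<subseteq> {..<n}" "(\<Sum>j<n. lookup (m + var_exp i) j) = Suc d"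
    by (auto simp: forms_def monomials_def)
  \<comment> \<open>\<open>m + var_exp i\<close> has a positive exponent at \<open>i\<close>, hence
    \<open>i < n\<close>; so the degree sum over \<open>{..<n}\<close> counts the extra
    \<open>1\<close>.\<close>
  have "keys m \<subseteq> {..<n}" "i < n"
    using m(1) by (auto simp: in_keys_iff lookup_add subset_iff)
  with m(2) show "m \<in> monomials n d"
    by (simp add: monomials_def lookup_add sum.distrib lookup_single when_def)
qed

lemma forms_0: "f \<in> forms n 0 \<Longrightarrow> f = const (lookup f 0)"
proof (rule poly_mapping_eqI)
  fix m assume f: "f \<in> forms n 0"
  have "m = 0" if "m \<in> keys f"
  proof (rule poly_mapping_eqI)
    fix i
    show "lookup m i = lookup 0 i"
      using f that by (cases "i < n") (auto simp: forms_def monomials_def in_keys_iff subset_iff)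
  qed
  then show "lookup f m = lookup (const (lookup f 0)) m"
    by (auto simp: const_def lookup_single when_def in_keys_iff)
qed

text \<open>Multiplying \<open>pdiff i f\<close> by \<open>x\<^sub>i\<close> restores each exponent
  \<open>m\<close> and scales its coefficient by \<open>lookup m i\<close>; these factors add up to
  the degree.\<close>

lemma euler_identity:
  assumes "f \<in> forms n d"
  shows "(\<Sum>i<n. Poly_Mapping.single (var_exp i) 1 * pdiff i f) = pscale (of_nat d) f"
proof (rule poly_mapping_eqI)
  fix m
  have *: "lookup (Poly_Mapping.single (var_exp i) 1 * pdiff i f) m =
      of_nat (lookup m i) * lookup f m" for i
  proof (cases "\<exists>b. m = var_exp i + b")
    case True
    then obtain b where "m = var_exp i + b" by blast
    then show ?thesis
      by (simp add: lookup_single_mult lookup_pdiff lookup_add add.commute)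
  next
    case False
    then have "lookup m i = 0"
      by (metis add.commute add_diff_cancel_right' diff_var_exp_add)
    with False show ?thesis by (simp add: lookup_single_mult)
  qed
  have "lookup (\<Sum>i<n. Poly_Mapping.single (var_exp i) 1 * pdiff i f) m =
      of_nat (\<Sum>i<n. lookup m i) * lookup f m"
    by (simp add: lookup_sum * sum_distrib_right)
  also have "\<dots> = of_nat d * lookup f m"
    using assms by (cases "m \<in> keys f") (auto simp: forms_def monomials_def in_keys_iff)
  finally show "lookup (\<Sum>i<n. Poly_Mapping.single (var_exp i) 1 * pdiff i f) m =
      lookup (pscale (of_nat d) f) m"
    by (simp add: lookup_pscale)
qed

subsection \<open>Columns of the catalecticant matrix as linear forms\<close>

definition grad_coeff :: "nat \<Rightarrow> 'k::field mvpoly \<Rightarrow> monom_exp \<Rightarrow> 'k mvpoly" where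
  "grad_coeff n f M = linear_form n (\<lambda>i. lookup (pdiff i f) M)"

lemma grad_coeff_in_forms: "grad_coeff n f M \<in> forms n 1"
  unfolding grad_coeff_def by (rule linear_form_in_forms)

lemma grad_coeff_add: "grad_coeff n (f + g) M = grad_coeff n f M + grad_coeff n g M"
  by (simp add: grad_coeff_def pdiff_add lookup_add linear_form_add)

text \<open>Leibniz' rule read off at \<open>M\<close>: the sums run over factorizations
  \<open>M = a + b\<close>, and one factor contributes only scalars, so no forms occur beyond those
  of \<open>f\<close> and \<open>g\<close>.\<close>

lemma grad_coeff_mult:
  "grad_coeff n (f * g) M =
    (\<Sum>a\<in>keys f. if \<exists>b. M = a + b then pscale (lookup f a) (grad_coeff n g (M - a)) else 0) +
    (\<Sum>a\<in>keys g. if \<exists>b. M = a + b then pscale (lookup g a) (grad_coeff n f (M - a)) else 0)"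
proof -
  have *: "linear_form n (\<lambda>i. lookup (f * pdiff i g) M) =
      (\<Sum>a\<in>keys f. if \<exists>b. M = a + b then pscale (lookup f a) (grad_coeff n g (M - a)) else 0)"
    for f g :: "'a mvpoly"
    unfolding lookup_mult_left linear_form_sum
    by (intro sum.cong) (auto simp: grad_coeff_def linear_form_scale linear_form_0)
  show ?thesis
    unfolding *[symmetric]
    by (simp add: grad_coeff_def pdiff_mult lookup_add linear_form_add mult.commute)
qed

text \<open>Partial derivatives commute, so the forms of \<open>pdiff i f\<close> are multiples of
  forms of \<open>f\<close>. This hands membership in a span down in an induction on the
  degree.\<close>

lemma grad_coeff_pdiff:
  "grad_coeff n (pdiff i f) M = pscale (of_nat (Suc (lookup M i))) (grad_coeff n f (M + var_exp i))"
  unfolding grad_coeff_def linear_form_scale[symmetric] pdiff_commute[of _ i]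
  by (simp add: lookup_pdiff[of i])

lemma grad_coeff_linear:
  assumes "y \<in> forms n 1"
  shows "grad_coeff n y M = (if M = 0 then y else 0)"
proof -
  have "pdiff i y = const (lookup y (var_exp i))" if "i < n" for i
    using forms_0[OF pdiff_in_forms[OF assms[unfolded One_nat_def]]] by (simp add: lookup_pdiff)
  then have "grad_coeff n y M =
      linear_form n (\<lambda>i. if M = 0 then lookup y (var_exp i) else 0)"
    unfolding grad_coeff_def linear_form_def
    by (intro sum.cong refl) (auto simp: const_def lookup_single)
  then show ?thesis
    using linear_form_coeffs[OF assms] by (simp add: linear_form_0)
qed

text \<open>Constants give \<open>0\<close>, a generator gives itself or \<open>0\<close>, and the
  product formula stays inside the span; it refers to exponents \<open>M - a\<close>, hence the
  generalization over \<open>M\<close>. This is the source of the lower bound on the number of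
  linear forms.\<close>

lemma grad_coeff_in_span:
  assumes "Y \<subseteq> forms n 1" "f \<in> subalg Y"
  shows "grad_coeff n f M \<in> mvpoly_span Y"
  using assms(2)
proof (induction arbitrary: M)
  case (const c)
  have "grad_coeff n (Defs.const c) M = 0"
    by (simp add: grad_coeff_def Defs.const_def pdiff_single linear_form_0)
  then show ?case by (simp add: mvpoly.span_zero)
next
  case (gen y)
  with assms(1) show ?case
    by (auto simp: grad_coeff_linear mvpoly.span_zero mvpoly.span_base subset_iff)
next
  case (add f g)
  then show ?case by (simp add: grad_coeff_add mvpoly.span_add)
next
  case (mult f g)
  then show ?case
    unfolding grad_coeff_mult
    by (intro mvpoly.span_add mvpoly.span_sum) (auto intro: mvpoly.span_scale mvpoly.span_zero)
qed

section \<open>Recovering \<open>f\<close> from the span of its gradient coefficients\<close>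

lemma span_subset_subalg: "mvpoly_span Y \<subseteq> subalg Y"
proof
  fix x assume "x \<in> mvpoly_span Y"
  then show "x \<in> subalg Y"
  proof (induction rule: mvpoly.span_induct_alt)
    case base
    show ?case using subalg.const[of 0] by (simp add: const_def)
  next
    case (step c x y)
    then show ?case
      unfolding pscale_def by (intro subalg.add subalg.mult subalg.const) (rule subalg.gen)
  qed
qed

lemma subalg_pscale: "f \<in> subalg Y \<Longrightarrow> pscale c f \<in> subalg Y"
  unfolding pscale_def by (intro subalg.mult subalg.const)

lemma subalg_sum: "(\<And>a. a \<in> A \<Longrightarrow> h a \<in> subalg Y) \<Longrightarrow> sum h A \<in> subalg Y"
proof (induction A rule: infinite_finite_induct)
  case (insert a A)
  then show ?case by (simp add: subalg.add)
qed (use subalg.const[of 0 Y] in \<open>simp_all add: const_def\<close>)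

text \<open>\<open>p i\<close> is the image of \<open>x\<^sub>i\<close> under a linear projection
  onto the span; the second property says in coordinates that the projection fixes the span.\<close>

lemma span_projection:
  fixes B :: "'k::field mvpoly set"
  assumes "B \<subseteq> forms n 1"
  obtains p where "\<And>i. p i \<in> mvpoly_span B"
    and "\<And>w. w \<in> mvpoly_span B \<Longrightarrow> (\<Sum>i<n. pscale (lookup w (var_exp i)) (p i)) = w"
proof -
  interpret pair: vector_space_pair "pscale :: 'k \<Rightarrow> _" "pscale :: 'k \<Rightarrow> _" ..
  \<comment> \<open>A left inverse of the identity on the subspace, with range in it, is a
    projection onto it.\<close>
  obtain g where g: "range g \<subseteq> mvpoly_span B" "Vector_Spaces.linear pscale pscale g"
      "\<And>v. v \<in> mvpoly_span B \<Longrightarrow> g v = v"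
    using pair.linear_exists_left_inverse_on[OF mvpoly.linear_id mvpoly.subspace_span[of B]]
    by auto
  interpret g: Vector_Spaces.linear "pscale :: 'k \<Rightarrow> _" "pscale :: 'k \<Rightarrow> _" g by (fact g(2))
  show thesis
  proof
    show "g (Poly_Mapping.single (var_exp i) 1) \<in> mvpoly_span B" for i
      using g(1) by blast
    fix w assume w: "w \<in> mvpoly_span B"
    then have "w \<in> forms n 1"
      using mvpoly.span_minimal[OF assms subspace_forms] by blast
    then have "w = (\<Sum>i<n. pscale (lookup w (var_exp i)) (Poly_Mapping.single (var_exp i) 1))"
      using linear_form_coeffs[of w n] by (simp add: linear_form_def pscale_single)
    then have "g w = (\<Sum>i<n. pscale (lookup w (var_exp i)) (g (Poly_Mapping.single (var_exp i) 1)))"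
      by (metis (no_types, lifting) g.scale g.sum sum.cong)
    with g(3)[OF w]
    show "(\<Sum>i<n. pscale (lookup w (var_exp i)) (g (Poly_Mapping.single (var_exp i) 1))) = w"
      by simp
  qed
qed

lemma subalg_if_grad_coeff:
  fixes f :: "'k::field_char_0 mvpoly"
  assumes B: "B \<subseteq> forms n 1" and "f \<in> forms n d" and "\<And>M. grad_coeff n f M \<in> mvpoly_span B"
  shows "f \<in> subalg B"
proof -
  obtain p where p: "\<And>i. p i \<in> mvpoly_span B"
    and proj: "\<And>w. w \<in> mvpoly_span B \<Longrightarrow> (\<Sum>i<n. pscale (lookup w (var_exp i)) (p i)) = w"
    using span_projection[OF B] by blast
  have p_form: "p i \<in> forms n 1" for i
    using p mvpoly.span_minimal[OF B subspace_forms] by blast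
  from assms(2,3) show ?thesis
  proof (induction d arbitrary: f)
    case 0
    then show ?case by (metis forms_0 subalg.const)
  next
    case (Suc d)
    \<comment> \<open>Every \<open>grad_coeff n f M\<close> is fixed by the projection; comparing
      coefficients at \<open>x\<^sub>j\<close>, for all \<open>M\<close> at once, turns this into an
      identity of polynomials.\<close>
    have diff: "pdiff j f = (\<Sum>i<n. pscale (lookup (p i) (var_exp j)) (pdiff i f))" if "j < n" for j
    proof (rule poly_mapping_eqI)
      fix M
      have "lookup (pdiff j f) M = lookup (grad_coeff n f M) (var_exp j)"
        using that by (simp add: grad_coeff_def lookup_linear_form_var)
      also have "\<dots> =
          lookup (\<Sum>i<n. pscale (lookup (grad_coeff n f M) (var_exp i)) (p i)) (var_exp j)"
        by (simp only: proj[OF Suc.prems(2)])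
      also have "\<dots> = lookup (\<Sum>i<n. pscale (lookup (p i) (var_exp j)) (pdiff i f)) M"
        by (simp add: lookup_sum lookup_pscale grad_coeff_def lookup_linear_form_var mult.commute)
      finally show "lookup (pdiff j f) M = \<dots>" .
    qed
    have "pscale (of_nat (Suc d)) f = (\<Sum>j<n. Poly_Mapping.single (var_exp j) 1 * pdiff j f)"
      using euler_identity[OF Suc.prems(1)] by simp
    also have "\<dots> = (\<Sum>j<n. Poly_Mapping.single (var_exp j) 1 *
        (\<Sum>i<n. pscale (lookup (p i) (var_exp j)) (pdiff i f)))"
      by (intro sum.cong refl arg_cong2[where f = "(*)"] diff) simp
    \<comment> \<open>Swapping the sums gathers, for each \<open>i\<close>, the terms of the linear
      form \<open>p i\<close> in front of \<open>pdiff i f\<close>.\<close>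
    also have "\<dots> = (\<Sum>i<n. \<Sum>j<n.
        Poly_Mapping.single (var_exp j) (lookup (p i) (var_exp j)) * pdiff i f)"
      unfolding sum_distrib_left
      by (subst sum.swap) (simp add: pscale_def const_def mult_single flip: mult.assoc)
    also have "\<dots> = (\<Sum>i<n. p i * pdiff i f)"
      unfolding sum_distrib_right[symmetric] linear_form_def[symmetric] linear_form_coeffs[OF p_form] ..
    finally have eq: "pscale (of_nat (Suc d)) f = (\<Sum>i<n. p i * pdiff i f)" .
    have "pdiff i f \<in> subalg B" for i
      using Suc.prems
      by (intro Suc.IH pdiff_in_forms) (auto simp: grad_coeff_pdiff intro: mvpoly.span_scale)
    then have "pscale (of_nat (Suc d)) f \<in> subalg B"
      unfolding eq using p span_subset_subalg by (intro subalg_sum subalg.mult) blast+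
    \<comment> \<open>Characteristic 0 makes the degree \<open>Suc d\<close> invertible.\<close>
    then have "pscale (1 / of_nat (Suc d)) (pscale (of_nat (Suc d)) f) \<in> subalg B"
      by (rule subalg_pscale)
    then show ?case by (simp del: of_nat_Suc)
  qed
qed

subsection \<open>Derivatives of order \<open>d - 1\<close>\<close>

text \<open>With \<open>m\<^sub>i\<close> for \<open>lookup m i\<close>, the factor is
  \<open>(m\<^sub>i + 1) \<dots> (m\<^sub>i + a)\<close>, nonzero in characteristic 0. What matters
  later is that it does not depend on \<open>g\<close>.\<close>

lemma lookup_pdiff_pow:
  "\<exists>c::'k::field_char_0. c \<noteq> 0 \<and>
    (\<forall>g. lookup ((pdiff i ^^ a) g) m = c * lookup g (m + Poly_Mapping.single i a))"
proof (induction a arbitrary: m)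
  case 0
  show ?case by (intro exI[of _ 1]) simp
next
  case (Suc a)
  obtain c :: 'k where c: "c \<noteq> 0"
    "\<And>g. lookup ((pdiff i ^^ a) g) (m + var_exp i) =
      c * lookup g (m + var_exp i + Poly_Mapping.single i a)"
    using Suc by blast
  have "m + var_exp i + Poly_Mapping.single i a = m + Poly_Mapping.single i (Suc a)"
    by (simp add: add.assoc plus_1_eq_Suc flip: single_add)
  with c show ?case
    by (intro exI[of _ "of_nat (Suc (lookup m i)) * c"])
      (simp add: lookup_pdiff mult.assoc del: of_nat_Suc)
qed

lemma lookup_pdiff_monom:
  fixes m :: monom_exp
  assumes "keys M \<subseteq> {..<n}"
  obtains c :: "'k::field_char_0"
    where "c \<noteq> 0" "\<And>g. lookup (pdiff_monom n M g) m = c * lookup g (m + M)"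
proof -
  have "\<exists>c::'k. c \<noteq> 0 \<and> (\<forall>g. lookup (foldr (\<lambda>i. pdiff i ^^ lookup M i) xs g) m =
      c * lookup g (m + (\<Sum>i\<leftarrow>xs. Poly_Mapping.single i (lookup M i))))" for xs
  proof (induction xs arbitrary: m)
    case Nil
    show ?case by (intro exI[of _ 1]) simp
  next
    case (Cons i xs)
    let ?e = "Poly_Mapping.single i (lookup M i)"
    obtain c :: 'k where "c \<noteq> 0"
      "\<And>g. lookup ((pdiff i ^^ lookup M i) g) m = c * lookup g (m + ?e)"
      using lookup_pdiff_pow by blast
    moreover obtain c' :: 'k where "c' \<noteq> 0"
      "\<And>g. lookup (foldr (\<lambda>i. pdiff i ^^ lookup M i) xs g) (m + ?e) =
        c' * lookup g (m + ?e + (\<Sum>i\<leftarrow>xs. Poly_Mapping.single i (lookup M i)))"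
      using Cons by blast
    ultimately show ?case
      by (intro exI[of _ "c * c'"]) (simp add: mult.assoc add.assoc)
  qed
  moreover have "(\<Sum>i\<leftarrow>[0..<n]. Poly_Mapping.single i (lookup M i)) = M"
  proof (rule poly_mapping_eqI)
    fix j
    have "j \<notin> keys M" if "\<not> j < n" using assms that by auto
    then show "lookup (\<Sum>i\<leftarrow>[0..<n]. Poly_Mapping.single i (lookup M i)) j = lookup M j"
      by (simp add: sum_list_distinct_conv_sum_set lookup_sum lookup_single when_def in_keys_iff
          split: if_splits)
  qed
  ultimately show thesis
    using that unfolding pdiff_monom_def by metis
qed

text \<open>\<open>pdiff i\<close> is itself \<open>pdiff_monom\<close> for the exponent
  \<open>var_exp i\<close>, and addition of exponents is commutative.\<close>

lemma pdiff_pdiff_monom: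
  assumes "i < n"
  shows "pdiff i (pdiff_monom n M f) = pdiff_monom n M (pdiff i f)"
proof -
  have "pdiff i g = pdiff_monom n (var_exp i) g" for g :: "'a mvpoly"
    using diff_act_var[OF assms, of g] by (simp add: diff_act_single)
  then show ?thesis
    by (metis add.commute pdiff_monom_mult)
qed

lemma pdiff_monom_in_forms:
  fixes f :: "'k::field_char_0 mvpoly"
  assumes "f \<in> forms n (e + d)" "M \<in> monomials n d"
  shows "pdiff_monom n M f \<in> forms n e"
  unfolding forms_def
proof (intro CollectI subsetI)
  have M: "keys M \<subseteq> {..<n}" using assms(2) by (simp add: monomials_def)
  fix m assume "m \<in> keys (pdiff_monom n M f)"
  then have "m + M \<in> keys f"
    using lookup_pdiff_monom[OF M, of m] by (metis in_keys_iff mult_zero_right)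
  with assms(1) have m: "keys (m + M) \<subseteq> {..<n}" "(\<Sum>i<n. lookup (m + M) i) = e + d"
    by (auto simp: forms_def monomials_def)
  have "keys m \<subseteq> {..<n}" using m(1) by (auto simp: in_keys_iff lookup_add subset_iff)
  with m(2) assms(2) show "m \<in> monomials n e"
    by (simp add: monomials_def lookup_add sum.distrib)
qed

text \<open>The coefficient of \<open>x\<^sub>i\<close> after applying the operator of
  \<open>M\<close> is the coefficient of \<open>M\<close> in \<open>pdiff i f\<close>, up to the
  factor \<open>M!\<close> common to all \<open>i\<close>.\<close>

lemma pdiff_monom_eq_grad_coeff:
  fixes f :: "'k::field_char_0 mvpoly"
  assumes "f \<in> forms n (Suc d)" "M \<in> monomials n d"
  obtains c where "c \<noteq> 0" "pdiff_monom n M f = pscale c (grad_coeff n f M)"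
proof -
  have "keys M \<subseteq> {..<n}" using assms(2) by (simp add: monomials_def)
  then obtain c :: 'k where c: "c \<noteq> 0"
    "\<And>g. lookup (pdiff_monom n M g) 0 = c * lookup g (0 + M)"
    by (rule lookup_pdiff_monom[where m = 0]) blast
  have "pdiff_monom n M f = pscale c (grad_coeff n f M)"
  proof (rule forms_1_eqI)
    show "pdiff_monom n M f \<in> forms n 1"
      using assms by (intro pdiff_monom_in_forms[of f n 1 d]) (simp_all add: plus_1_eq_Suc)
    show "pscale c (grad_coeff n f M) \<in> forms n 1"
      by (intro mvpoly.subspace_scale subspace_forms grad_coeff_in_forms)
    fix i assume i: "i < n"
    \<comment> \<open>One further derivative moves the coefficient at \<open>x\<^sub>i\<close> to
      the exponent \<open>0\<close>, where the equation for \<open>c\<close> applies.\<close>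
    have "lookup (pdiff_monom n M f) (var_exp i) = lookup (pdiff i (pdiff_monom n M f)) 0"
      by (simp add: lookup_pdiff)
    also have "\<dots> = c * lookup (pdiff i f) M"
      using i c(2) by (simp add: pdiff_pdiff_monom)
    finally show "lookup (pdiff_monom n M f) (var_exp i) =
        lookup (pscale c (grad_coeff n f M)) (var_exp i)"
      using i by (simp add: lookup_pscale grad_coeff_def lookup_linear_form_var)
  qed
  with c(1) that show thesis by blast
qed

text \<open>Here \<open>d\<close> stands for the \<open>d - 1\<close> of the overview. Operators of
  degree \<open>d\<close> are combinations of monomials, whose derivatives are nonzero multiples of
  the \<open>g\<^sub>M\<close>; nonzero factors do not change a span.\<close>

lemma span_derivatives_eq:
  fixes f :: "'k::field_char_0 mvpoly"
  assumes "f \<in> forms n (Suc d)"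
  shows "mvpoly_span {diff_act n D f | D. D \<in> forms n d} =
    mvpoly_span (grad_coeff n f ` monomials n d)" (is "?L = ?R")
proof (rule antisym)
  have "{diff_act n D f | D. D \<in> forms n d} \<subseteq> ?R"
  proof clarify
    fix D :: "'k mvpoly" assume "D \<in> forms n d"
    then show "diff_act n D f \<in> ?R"
      unfolding diff_act_def
    proof (intro mvpoly.span_sum mvpoly.span_scale)
      fix M assume "M \<in> keys D"
      with \<open>D \<in> forms n d\<close> have M: "M \<in> monomials n d" by (auto simp: forms_def)
      with assms obtain c where "pdiff_monom n M f = pscale c (grad_coeff n f M)"
        by (rule pdiff_monom_eq_grad_coeff)
      with M show "pdiff_monom n M f \<in> ?R"
        by (auto intro: mvpoly.span_scale mvpoly.span_base)
    qed
  qed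
  then show "?L \<subseteq> ?R" by (simp add: mvpoly.span_minimal)
  have "grad_coeff n f ` monomials n d \<subseteq> ?L"
  proof clarify
    fix M assume M: "M \<in> monomials n d"
    with assms obtain c where c: "c \<noteq> 0" "pdiff_monom n M f = pscale c (grad_coeff n f M)"
      by (rule pdiff_monom_eq_grad_coeff)
    have "diff_act n (Poly_Mapping.single M (inverse c)) f = grad_coeff n f M"
      using c by (simp add: diff_act_single)
    moreover have "Poly_Mapping.single M (inverse c) \<in> forms n d"
      using M by (auto simp: forms_def)
    ultimately show "grad_coeff n f M \<in> ?L"
      by (metis (mono_tags, lifting) mem_Collect_eq mvpoly.span_base)
  qed
  then show "?R \<subseteq> ?L" by (simp add: mvpoly.span_minimal)
qed

text \<open>Settles the exponents that are not columns of the matrix, since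
  \<open>subalg_if_grad_coeff\<close> asks for arbitrary \<open>M\<close>.\<close>

lemma grad_coeff_eq_0:
  assumes "f \<in> forms n (Suc d)" "M \<notin> monomials n d"
  shows "grad_coeff n f M = 0"
proof -
  have "lookup (pdiff i f) M = 0" for i
    using pdiff_in_forms[OF assms(1), of i] assms(2) by (auto simp: forms_def in_keys_iff subset_iff)
  then show ?thesis by (simp add: grad_coeff_def linear_form_0)
qed

subsection \<open>Rank\<close>

lemma inj_on_linear_form_vec: "inj_on (\<lambda>v. linear_form n (($) v)) (carrier_vec n)"
proof (rule inj_onI)
  fix u v :: "'a vec"
  assume "u \<in> carrier_vec n" "v \<in> carrier_vec n" "linear_form n (($) u) = linear_form n (($) v)"
  then show "u = v"
    by (intro eq_vecI) (auto, metis lookup_linear_form_var)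
qed

text \<open>Matrix rank lives in \<open>k^n\<close>, spans of forms in the polynomial space. The
  injective linear map from vectors to forms carries linear relations across in both
  directions.\<close>

lemma linear_form_independent_iff:
  fixes S :: "'k::field vec set"
  assumes "S \<subseteq> carrier_vec n" "finite S"
  shows "mvpoly.independent ((\<lambda>v. linear_form n (($) v)) ` S) \<longleftrightarrow>
    \<not> module.lin_dep class_ring (module_vec TYPE('k) n) S"
proof -
  interpret V: vec_space "TYPE('k)" n .
  let ?L = "\<lambda>v::'k vec. linear_form n (($) v)"
  have inj: "inj_on ?L S" using inj_on_linear_form_vec assms(1) by (rule inj_on_subset)
  have comb: "(\<Sum>v\<in>S. pscale (a v) (?L v)) = ?L (V.lincomb a S)" for a
  proof -
    have "(\<Sum>v\<in>S. pscale (a v) (?L v)) = linear_form n (\<lambda>i. \<Sum>v\<in>S. a v * v $ i)"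
      by (simp add: linear_form_sum linear_form_scale)
    also have "\<dots> = ?L (V.lincomb a S)"
      unfolding linear_form_def
      by (intro sum.cong refl) (simp add: V.lincomb_index assms(1))
    finally show ?thesis .
  qed
  have zero: "?L (V.lincomb a S) = 0 \<longleftrightarrow> V.lincomb a S = 0\<^sub>v n" for a
    unfolding linear_form_eq_0_iff using V.lincomb_dim[OF assms(2,1), of a]
    by (metis eq_vecI index_zero_vec)
  have "mvpoly.dependent (?L ` S) \<longleftrightarrow> V.lin_dep S"
  proof
    assume "mvpoly.dependent (?L ` S)"
    then obtain u v where u: "v \<in> S" "u (?L v) \<noteq> 0" "(\<Sum>x\<in>?L ` S. pscale (u x) x) = 0"
      using assms(2) by (auto simp: mvpoly.dependent_finite)
    have "V.lincomb (\<lambda>v. u (?L v)) S = 0\<^sub>v n"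
      using u(3) by (simp add: sum.reindex[OF inj] comb zero)
    then show "V.lin_dep S"
      unfolding V.lin_dep_def using u assms(2)
      by (intro exI[of _ S] exI[of _ "\<lambda>v. u (?L v)"] exI[of _ v]) (auto simp: class_ring_simps)
  next
    assume "V.lin_dep S"
    then obtain a v where a: "V.lincomb a S = 0\<^sub>v n" "v \<in> S" "a v \<noteq> 0"
      using V.finite_lin_dep[OF assms(2)] assms(1) by (auto simp: class_ring_simps)
    \<comment> \<open>A relation among forms is indexed by the forms themselves, so the coefficients
      are transported along the inverse of the injection.\<close>
    let ?u = "\<lambda>x. a (the_inv_into S ?L x)"
    have "(\<Sum>x\<in>?L ` S. pscale (?u x) x) = (\<Sum>v\<in>S. pscale (a v) (?L v))"
      by (simp add: sum.reindex[OF inj] the_inv_into_f_f[OF inj])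
    also have "\<dots> = 0" using a(1) by (simp add: comb linear_form_eq_0_iff)
    finally show "mvpoly.dependent (?L ` S)"
      using a(2,3) assms(2) the_inv_into_f_f[OF inj a(2)]
      by (auto simp: mvpoly.dependent_finite intro!: exI[of _ ?u] bexI[of _ v])
  qed
  then show ?thesis by blast
qed

text \<open>The rank is the size of a maximal independent set of columns, and the forms of such a
  set are a basis of the span of all column forms.\<close>

lemma rank_basis:
  fixes A :: "'k::field mat"
  assumes A: "A \<in> carrier_mat n nc"
  obtains B where "B \<subseteq> (\<lambda>v. linear_form n (($) v)) ` set (cols A)" "finite B"
    "mvpoly.independent B" "card B = vec_space.rank n A"
    "(\<lambda>v. linear_form n (($) v)) ` set (cols A) \<subseteq> mvpoly_span B"
proof -
  interpret V: vec_space "TYPE('k)" n .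
  let ?L = "\<lambda>v::'k vec. linear_form n (($) v)"
  let ?P = "\<lambda>T. T \<subseteq> set (cols A) \<and> V.lin_indpt T"
  have carr: "set (cols A) \<subseteq> carrier_vec n" using A cols_dim by blast
  have "?P {}" by (auto simp: V.lin_dep_def)
  then obtain S where S: "finite S" "maximal S ?P"
    using maximal_exists_superset[of "set (cols A)" ?P "{}"] by auto
  have sub: "S \<subseteq> set (cols A)" and ind: "V.lin_indpt S"
    using S(2) by (auto simp: maximal_def)
  have indL: "mvpoly.independent (?L ` S)"
    using ind sub carr by (subst linear_form_independent_iff[OF _ S(1)]) auto
  have "?L ` set (cols A) \<subseteq> mvpoly_span (?L ` S)"
  proof clarify
    fix c assume c: "c \<in> set (cols A)"
    show "?L c \<in> mvpoly_span (?L ` S)"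
    proof (rule ccontr)
      assume not: "?L c \<notin> mvpoly_span (?L ` S)"
      then have "mvpoly.independent (?L ` insert c S)"
        using indL by (simp add: mvpoly.independent_insertI)
      \<comment> \<open>Independence of the enlarged set pulls back to the columns, against the
        maximality of \<open>S\<close>.\<close>
      then have "?P (insert c S)"
        using linear_form_independent_iff[of "insert c S" n] c sub carr S(1) by auto
      then have "c \<in> S" using S(2) unfolding maximal_def by blast
      with not show False by (simp add: mvpoly.span_base)
    qed
  qed
  moreover have "card (?L ` S) = V.rank A"
    using V.rank_card_indpt[OF A S(2)] inj_on_linear_form_vec sub carr
    by (metis card_image inj_on_subset)
  ultimately show thesis
    using that[of "?L ` S"] sub indL S(1) by blast
qed

section \<open>Essential variables and the rank of the catalecticant matrix\<close>

lemma cols_catalecticant: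
  "(\<lambda>v. linear_form n (($) v)) ` set (cols (catalecticant n Ms f)) = grad_coeff n f ` set Ms"
proof -
  have "linear_form n (($) (col (catalecticant n Ms f) j)) = grad_coeff n f (Ms ! j)"
    if "j < length Ms" for j
    using that by (simp add: linear_form_def grad_coeff_def catalecticant_def)
  moreover have "dim_col (catalecticant n Ms f) = length Ms"
    by (simp add: catalecticant_def)
  ultimately show ?thesis
    by (auto simp: cols_def set_conv_nth image_iff) force+
qed

theorem proposition1:
  fixes f :: "'k::field_char_0 mvpoly" and n d :: nat and Ms :: "monom_exp list"
  assumes "d \<ge> 1"
    and "f \<in> forms n d"
    and "distinct Ms" and "set Ms = monomials n (d - 1)"
  shows "N_ess n f = vec_space.rank n (catalecticant n Ms f) \<and>
    EssVar n f = mvpoly_span {diff_act n D f | D. D \<in> forms n (d - 1)} \<and>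
    (\<forall>ys. length ys = N_ess n f \<and> set ys \<subseteq> forms n 1 \<and> f \<in> subalg (set ys) \<longrightarrow>
       mvpoly_span (set ys) = mvpoly_span {diff_act n D f | D. D \<in> forms n (d - 1)})"
proof -
  let ?r = "vec_space.rank n (catalecticant n Ms f)"
  let ?G = "grad_coeff n f ` monomials n (d - 1)"
  let ?W = "mvpoly_span {diff_act n D f | D. D \<in> forms n (d - 1)}"
  have f: "f \<in> forms n (Suc (d - 1))" using assms(1,2) by simp
  have W: "?W = mvpoly_span ?G" by (rule span_derivatives_eq[OF f])
  have "catalecticant n Ms f \<in> carrier_mat n (length Ms)" by (simp add: catalecticant_def)
  then obtain B where B: "B \<subseteq> ?G" "finite B" "mvpoly.independent B" "card B = ?r"
    "?G \<subseteq> mvpoly_span B"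
    using rank_basis[of "catalecticant n Ms f" n] unfolding cols_catalecticant assms(4) by metis
  have spanB: "mvpoly_span B = ?W"
    unfolding W using B(1,5)
    by (metis mvpoly.span_mono mvpoly.span_minimal mvpoly.subspace_span antisym)
  have forms_B: "B \<subseteq> forms n 1" using B(1) grad_coeff_in_forms by blast
  have "grad_coeff n f M \<in> mvpoly_span B" for M
  proof (cases "M \<in> monomials n (d - 1)")
    case True
    with B(5) show ?thesis by blast
  next
    case False
    with f show ?thesis by (simp add: grad_coeff_eq_0 mvpoly.span_zero)
  qed
  with forms_B f have subalg_B: "f \<in> subalg B" by (rule subalg_if_grad_coeff)
  obtain bs where bs: "set bs = B" "distinct bs" using finite_distinct_list[OF B(2)] by blast
  have len_bs: "length bs = ?r" using bs B(4) distinct_card by fastforce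
  have B_sub: "B \<subseteq> mvpoly_span (set ys)" if "set ys \<subseteq> forms n 1" "f \<in> subalg (set ys)" for ys
    using B(1) grad_coeff_in_span[OF that] by blast
  \<comment> \<open>\<open>B\<close> is independent inside a span of at most
    \<open>length ys\<close> vectors; \<open>ys\<close> may contain repetitions, hence
    \<open>card_length\<close>.\<close>
  have lower: "?r \<le> length ys" if "set ys \<subseteq> forms n 1" "f \<in> subalg (set ys)" for ys
    using mvpoly.independent_span_bound[OF finite_set B(3) B_sub[OF that]] B(4) card_length[of ys]
    by linarith
  have N: "N_ess n f = ?r"
    unfolding N_ess_def
  proof (rule Least_equality)
    show "\<exists>ys. length ys = ?r \<and> set ys \<subseteq> forms n 1 \<and> f \<in> subalg (set ys)"
      using len_bs bs forms_B subalg_B by auto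
  qed (use lower in blast)
  have span: "mvpoly_span (set ys) = ?W"
    if ys: "length ys = N_ess n f" "set ys \<subseteq> forms n 1" "f \<in> subalg (set ys)" for ys
  proof -
    \<comment> \<open>A \<open>y\<close> outside the span of \<open>B\<close> would give
      \<open>?r + 1\<close> independent forms in the span of \<open>?r\<close> forms.\<close>
    have "y \<in> mvpoly_span B" if "y \<in> set ys" for y
    proof (rule ccontr)
      assume y: "y \<notin> mvpoly_span B"
      then have ind: "mvpoly.independent (insert y B)"
        using B(3) by (rule mvpoly.independent_insertI)
      have "insert y B \<subseteq> mvpoly_span (set ys)"
        using that B_sub[OF ys(2,3)] by (simp add: mvpoly.span_base)
      from mvpoly.independent_span_bound[OF finite_set ind this]
      have "card (insert y B) \<le> length ys" using card_length[of ys] by linarith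
      moreover have "y \<notin> B" using y mvpoly.span_base by blast
      ultimately show False using B(2,4) ys(1) N by simp
    qed
    then have "mvpoly_span (set ys) \<subseteq> mvpoly_span B"
      by (intro mvpoly.span_minimal) auto
    moreover have "mvpoly_span B \<subseteq> mvpoly_span (set ys)"
      using B_sub[OF ys(2,3)] by (intro mvpoly.span_minimal) auto
    ultimately show ?thesis using spanB by simp
  qed
  \<comment> \<open>The list \<open>bs\<close> gives existence; uniqueness holds because every
    minimal list has span \<open>?W\<close>.\<close>
  have "EssVar n f = ?W"
    unfolding EssVar_def
  proof (rule the_equality)
    show "\<exists>ys. minimal_linear_forms n f ys \<and> ?W = mvpoly_span (set ys)"
      unfolding minimal_linear_forms_def N using len_bs bs forms_B subalg_B spanB by auto
    show "V = ?W" if "\<exists>ys. minimal_linear_forms n f ys \<and> V = mvpoly_span (set ys)" for V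
      using that span unfolding minimal_linear_forms_def by blast
  qed
  with N span show ?thesis by blast
qed

end
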